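(* Let $X$ be a compact metric space, let $A\subseteq X$, let $G$ be a closed relation on $X$, let $k$ be a positive integer such that $k\geq 2$, and let $\varepsilon>0$ be such that $G$ has a $(k,\varepsilon)$-return on $A$. Then $$\mathrm{ent}(G)\geq \frac{\log(2)}{k}.$$
   Context: $\rho$ denotes the metric on $X$. A closed relation on $X$ is a subset $G\subseteq X\times X$ that is closed in $X\times X$. Mahavier products: for each positive integer $m$, $$\star_{i=1}^{m}G^{-1}=\{(x_1,\ldots,x_{m+1})\in X^{m+1} : (x_{i+1},x_i)\in G \text{ for each } i\in\{1,\ldots,m\}\}.$$ Returns: let $A$ be a non-empty subset of $X$, $k\ge 2$ an integer and $\varepsilon>0$. $G$ has a $(k,\varepsilon)$-return on $A$ if for each $a\in A$ there are integers $j,j'$ with $1<j'\leq j\leq k$ and points $(x_1,\ldots,x_j),(y_1,\ldots,y_j)\in \star_{i=1}^{j-1}G^{-1}$ such that (1) $a=x_1=y_1$, (2) $\{x_j,y_j\}\subseteq A$, (3) $\rho(x_{j'},y_{j'})>\varepsilon$. (In particular, having a $(k,\varepsilon)$-return on $A$ includes that $A$ is non-empty.) Entropy: for a non-empty open cover $\alpha$ of $X$ and a positive integer $n$ let $\alpha^{n}=\{S_1\times\cdots\times S_n : S_1,\ldots,S_n\in\alpha\}$. For a closed $K\subseteq X^n$ and a non-empty family $\mathcal U$ of open subsets of $X^n$ covering $K$, $N(K,\mathcal U)$ is the minimal cardinality of a non-empty subfamily of $\mathcal U$ that covers $K$. Define $\mathrm{ent}(G,\alpha)=\lim_{m\to\infty}\frac{\log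 N(\star_{i=1}^{m}G^{-1},\alpha^{m+1})}{m}$ (this limit is known to exist), and, for $G\neq\emptyset$, $\mathrm{ent}(G)=\sup_\alpha \mathrm{ent}(G,\alpha)\in[0,\infty]$, the supremum over all non-empty open covers $\alpha$ of $X$ (equal to $\infty$ if the set of values is unbounded). *)

theory Defs
  imports "HOL-Analysis.Analysis"
begin

text \<open>
  The space is a carrier set \<open>X\<close> in a type of class \<^class>\<open>metric_space\<close>, with the subspace
  topology; the metric is \<^const>\<open>dist\<close>.  Points of $X^n$ are the extensional functions
  \<open>{1..n} \<rightarrow>\<^sub>E X\<close>, so coordinates are numbered from 1.
\<close>

definition closed_relation_on :: "'a::metric_space set \<Rightarrow> ('a \<times> 'a) set \<Rightarrow> bool" where
  "closed_relation_on X G \<longleftrightarrow> closedin (top_of_set (X \<times> X)) G"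

text \<open>The Mahavier product \<open>\<star>\<^sub>i\<^sub>=\<^sub>1\<^sup>m G\<^sup>-\<^sup>1\<close>; each coordinate is a \<open>G\<close>-predecessor of the one before it.\<close>

definition mahavier :: "'a set \<Rightarrow> ('a \<times> 'a) set \<Rightarrow> nat \<Rightarrow> (nat \<Rightarrow> 'a) set" where
  "mahavier X G m =
     {x \<in> {1..m+1} \<rightarrow>\<^sub>E X. \<forall>i\<in>{1..m}. (x (i + 1), x i) \<in> G}"

definition has_return ::
  "'a::metric_space set \<Rightarrow> ('a \<times> 'a) set \<Rightarrow> nat \<Rightarrow> real \<Rightarrow> 'a set \<Rightarrow> bool" where
  "has_return X G k \<epsilon> A \<longleftrightarrow>
     A \<noteq> {} \<and>
     (\<forall>a\<in>A. \<exists>j j'. 1 < j' \<and> j' \<le> j \<and> j \<le> k \<and>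
        (\<exists>x\<in>mahavier X G (j - 1). \<exists>y\<in>mahavier X G (j - 1).
           a = x 1 \<and> a = y 1 \<and> {x j, y j} \<subseteq> A \<and> dist (x j') (y j') > \<epsilon>))"

definition open_cover :: "'a::topological_space set \<Rightarrow> 'a set set \<Rightarrow> bool" where
  "open_cover X \<alpha> \<longleftrightarrow> \<alpha> \<noteq> {} \<and> (\<forall>S\<in>\<alpha>. openin (top_of_set X) S) \<and> \<Union>\<alpha> = X"

definition cover_power :: "'a set set \<Rightarrow> nat \<Rightarrow> (nat \<Rightarrow> 'a) set set" where
  "cover_power \<alpha> n = {Pi\<^sub>E {1..n} S | S. \<forall>i\<in>{1..n}. S i \<in> \<alpha>}"

text \<open>
  Only finite subfamilies are counted, because \<^const>\<open>card\<close> is 0 on infinite sets.  For open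
  covers of a compact set a finite subcover exists, so this is the minimal cardinality among
  all non-empty subcovers.  It is at least 1, even when \<open>K\<close> is empty.
\<close>

definition cover_number :: "'b set \<Rightarrow> 'b set set \<Rightarrow> nat" where
  "cover_number K U = (LEAST n. \<exists>V\<subseteq>U. V \<noteq> {} \<and> finite V \<and> K \<subseteq> \<Union>V \<and> card V = n)"

definition ent_cover :: "'a set \<Rightarrow> ('a \<times> 'a) set \<Rightarrow> 'a set set \<Rightarrow> real" where
  "ent_cover X G \<alpha> =
     lim (\<lambda>m. ln (real (cover_number (mahavier X G m) (cover_power \<alpha> (m + 1)))) / real m)"

definition ent :: "'a::metric_space set \<Rightarrow> ('a \<times> 'a) set \<Rightarrow> ereal" where
  "ent X G = (SUP \<alpha>\<in>{\<alpha>. open_cover X \<alpha>}. ereal (ent_cover X G \<alpha>))"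

end

theory Submission
  imports Defs
begin

text \<open>
  Each point of \<open>A\<close> starts two orbits that come back to \<open>A\<close> within \<open>k - 1\<close> steps and are
  more than \<open>\<epsilon>\<close> apart at some common time on the way.  From the two end points, which lie
  in \<open>A\<close> again, the same choice can be made, and so on: after \<open>n\<close> rounds of branching
  there are \<open>2^n\<close> orbits of length at most \<open>n (k - 1)\<close>.  Any two of them agree up to the
  round in which their choices first differ, and in this round, having used the same time up to
  then, they are \<open>\<epsilon>\<close>-separated at a common time (lemma \<open>has_return_separated\<close>).

  Cover \<open>X\<close> by balls of radius \<open>\<epsilon>/2\<close>.  No product of such balls contains two
  \<open>\<epsilon>\<close>-separated orbits, so at least \<open>2^n\<close> products are needed
  (lemma \<open>card_le_cover_number\<close>).  Along the lengths \<open>m = n (k - 1)\<close> the quotient in the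
  definition of the entropy is therefore at least \<open>ln 2 / (k - 1)\<close>.

  To conclude something about the value of \<^const>\<open>lim\<close>, convergence of the whole sequence of
  quotients is needed.  Cutting an orbit in two shows that the cover numbers are submultiplicative
  (lemma \<open>cover_number_mahavier_add\<close>), and Fekete's lemma applies to their logarithms.
\<close>

section \<open>Fekete's lemma\<close>

lemma subadditive_multiple:
  fixes a :: "nat \<Rightarrow> real"
  assumes "\<And>m n. a (m + n) \<le> a m + a n"
  shows "a (q * p + r) \<le> real q * a p + a r"
proof (induction q)
  case (Suc q)
  have "a (Suc q * p + r) = a (p + (q * p + r))" by (simp add: algebra_simps)
  also have "\<dots> \<le> a p + a (q * p + r)" by (rule assms)
  finally show ?case using Suc by (simp add: algebra_simps)
qed simp

text \<open>
  Dividing \<open>n\<close> by a fixed \<open>p\<close> with remainder shows that \<open>a n / n\<close> exceeds \<open>a p / p\<close> by at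
  most a constant over \<open>n\<close>.  Hence the quotients come close to their infimum and stay there.
\<close>

lemma fekete_convergent:
  fixes a :: "nat \<Rightarrow> real"
  assumes sub: "\<And>m n. a (m + n) \<le> a m + a n"
    and nonneg: "\<And>n. 0 \<le> a n"
  shows "convergent (\<lambda>n. a n / real n)"
proof -
  define L where "L = (INF n\<in>{1..}. a n / real n)"
  have bdd: "bdd_below ((\<lambda>n. a n / real n) ` {1..})"
    by (rule bdd_belowI[where m = 0]) (use nonneg in auto)
  have lower: "L \<le> a n / real n" if "n \<ge> 1" for n
    unfolding L_def by (rule cINF_lower[OF bdd]) (use that in auto)
  have "(\<lambda>n. a n / real n) \<longlonglongrightarrow> L"
  proof (rule order_tendstoI)
    fix y assume "y < L"
    then show "\<forall>\<^sub>F n in sequentially. y < a n / real n"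
      using lower by (intro eventually_sequentiallyI[of 1]) (auto intro: less_le_trans)
  next
    fix y assume y: "L < y"
    obtain p where p: "p \<ge> 1" "a p / real p < y"
      using cINF_less_iff[OF _ bdd, of y] y unfolding L_def by auto
    define C where "C = (\<Sum>r<p. a r)"
    have "(\<lambda>n. a p / real p + C / real n) \<longlonglongrightarrow> a p / real p + 0"
      by (intro tendsto_intros lim_const_over_n)
    then have "\<forall>\<^sub>F n in sequentially. a p / real p + C / real n < y"
      using p(2) by (intro order_tendstoD) auto
    moreover have "\<forall>\<^sub>F n in sequentially. a n / real n \<le> a p / real p + C / real n"
    proof (rule eventually_sequentiallyI[of 1])
      fix n :: nat assume n: "1 \<le> n"
      have C: "a (n mod p) \<le> C"
        unfolding C_def by (rule member_le_sum) (use p nonneg in auto)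
      have "real (n div p) * real p \<le> real n"
        by (metis of_nat_mult of_nat_le_iff div_times_less_eq_dividend)
      then have q: "real (n div p) \<le> real n / real p"
        using p by (simp add: field_simps)
      have "a n \<le> real (n div p) * a p + a (n mod p)"
        using subadditive_multiple[of a "n div p" p "n mod p", OF sub] by simp
      also have "\<dots> \<le> real n / real p * a p + C"
        by (intro add_mono mult_right_mono q C nonneg)
      finally show "a n / real n \<le> a p / real p + C / real n"
        using n by (simp add: field_simps)
    qed
    ultimately show "\<forall>\<^sub>F n in sequentially. a n / real n < y"
      by eventually_elim linarith
  qed
  then show ?thesis by (rule convergentI)
qed

section \<open>Cover numbers\<close>

lemma cover_number_le:
  assumes "V \<subseteq> U" "V \<noteq> {}" "finite V" "K \<subseteq> \<Union>V"
  shows "cover_number K U \<le> card V"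
  unfolding cover_number_def by (rule Least_le) (use assms in blast)

lemma cover_number_attained:
  assumes "V \<subseteq> U" "V \<noteq> {}" "finite V" "K \<subseteq> \<Union>V"
  obtains W where "W \<subseteq> U" "W \<noteq> {}" "finite W" "K \<subseteq> \<Union>W" "card W = cover_number K U"
proof -
  have "\<exists>W\<subseteq>U. W \<noteq> {} \<and> finite W \<and> K \<subseteq> \<Union>W \<and> card W = cover_number K U"
    unfolding cover_number_def
    by (rule LeastI[where P = "\<lambda>n. \<exists>V\<subseteq>U. V \<noteq> {} \<and> finite V \<and> K \<subseteq> \<Union>V \<and> card V = n"
          and k = "card V"]) (use assms in blast)
  then show ?thesis using that by blast
qed

text \<open>
  Choosing for each point of \<open>E\<close> a member of an optimal subcover that contains it is an
  injection.  The family \<open>V\<close> only serves to show that finite subcovers exist.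
\<close>

lemma card_le_cover_number:
  assumes "V \<subseteq> U" "V \<noteq> {}" "finite V" "K \<subseteq> \<Union>V"
    and E: "E \<subseteq> K"
    and single: "\<And>u v S. u \<in> E \<Longrightarrow> v \<in> E \<Longrightarrow> S \<in> U \<Longrightarrow> u \<in> S \<Longrightarrow> v \<in> S \<Longrightarrow> u = v"
  shows "card E \<le> cover_number K U"
proof -
  obtain W where W: "W \<subseteq> U" "finite W" "K \<subseteq> \<Union>W" "card W = cover_number K U"
    by (rule cover_number_attained[OF assms(1-4)])
  have "\<forall>e\<in>E. \<exists>S\<in>W. e \<in> S" using E W(3) by blast
  then obtain h where h: "\<And>e. e \<in> E \<Longrightarrow> h e \<in> W \<and> e \<in> h e" by metis
  have "inj_on h E"
    using h single W(1) by (intro inj_onI) (metis subsetD)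
  then show ?thesis using card_inj_on_le[of h E W] h W by auto
qed

section \<open>Orbits\<close>

lemma mahavier_mem:
  assumes "x \<in> mahavier X G m" "1 \<le> i" "i \<le> m + 1"
  shows "x i \<in> X"
  using assms by (auto simp: mahavier_def)

lemma mahavier_step:
  assumes "x \<in> mahavier X G m" "1 \<le> i" "i \<le> m"
  shows "(x (Suc i), x i) \<in> G"
  using assms by (auto simp: mahavier_def)

lemma mahavier_segment:
  assumes "x \<in> mahavier X G l" "s + m \<le> l"
  shows "(\<lambda>i\<in>{1..m+1}. x (i + s)) \<in> mahavier X G m"
  using mahavier_mem[OF assms(1)] mahavier_step[OF assms(1)] assms(2)
  by (auto simp: mahavier_def)

text \<open>
  Sequences overlap in one coordinate, where the value from \<open>x\<close> is taken.  For orbits the two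
  values are the same point; for the sides of boxes, which are joined below, they may differ.
\<close>

definition join :: "nat \<Rightarrow> nat \<Rightarrow> (nat \<Rightarrow> 'a) \<Rightarrow> (nat \<Rightarrow> 'a) \<Rightarrow> nat \<Rightarrow> 'a" where
  "join p m x z = (\<lambda>i\<in>{1..p+m+1}. if i \<le> p + 1 then x i else z (i - p))"

lemma join_left: "1 \<le> i \<Longrightarrow> i \<le> p + 1 \<Longrightarrow> join p m x z i = x i"
  by (simp add: join_def)

lemma join_right:
  assumes "x (p + 1) = z 1" "1 \<le> i" "i \<le> m + 1"
  shows "join p m x z (p + i) = z i"
  using assms by (cases "i = 1") (auto simp: join_def)

lemma join_mahavier:
  assumes x: "x \<in> mahavier X G p" and z: "z \<in> mahavier X G m" and meet: "x (p + 1) = z 1"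
  shows "join p m x z \<in> mahavier X G (p + m)"
proof -
  have "join p m x z i \<in> X" if "i \<in> {1..p+m+1}" for i
    using that mahavier_mem[OF x, of i] mahavier_mem[OF z, of "i - p"] by (auto simp: join_def)
  moreover have "(join p m x z (i + 1), join p m x z i) \<in> G" if i: "i \<in> {1..p+m}" for i
  proof (cases "i \<le> p")
    case True
    then show ?thesis using mahavier_step[OF x, of i] i by (simp add: join_left)
  next
    case False
    define i' where "i' = i - p"
    have i': "i = p + i'" "1 \<le> i'" "i' \<le> m" using False i by (auto simp: i'_def)
    then show ?thesis
      using mahavier_step[OF z, of i'] join_right[of x p z i' m, OF meet]
        join_right[of x p z "i' + 1" m, OF meet] by simp
  qed
  moreover have "join p m x z \<in> extensional {1..p+m+1}" by (simp add: join_def)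
  ultimately show ?thesis by (auto simp: mahavier_def PiE_def)
qed

section \<open>Submultiplicativity of the cover numbers\<close>

lemma cover_power_finite_subcover:
  assumes "\<beta> \<subseteq> \<alpha>" "finite \<beta>" "\<beta> \<noteq> {}" "X \<subseteq> \<Union>\<beta>"
  obtains V where "V \<subseteq> cover_power \<alpha> (m + 1)" "V \<noteq> {}" "finite V" "mahavier X G m \<subseteq> \<Union>V"
proof
  let ?V = "(\<lambda>S. Pi\<^sub>E {1..m+1} S) ` ({1..m+1} \<rightarrow>\<^sub>E \<beta>)"
  show "?V \<subseteq> cover_power \<alpha> (m + 1)"
    using assms(1) unfolding cover_power_def by blast
  show "?V \<noteq> {}" using assms(3) by (simp add: PiE_eq_empty_iff)
  show "finite ?V" using assms(2) by (intro finite_imageI finite_PiE) auto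
  show "mahavier X G m \<subseteq> \<Union>?V"
  proof
    fix x assume x: "x \<in> mahavier X G m"
    then have "\<forall>i\<in>{1..m+1}. \<exists>S\<in>\<beta>. x i \<in> S"
      using assms(4) mahavier_mem[OF x] by fastforce
    then obtain S where S: "\<And>i. i \<in> {1..m+1} \<Longrightarrow> S i \<in> \<beta> \<and> x i \<in> S i" by metis
    have "restrict S {1..m+1} \<in> {1..m+1} \<rightarrow>\<^sub>E \<beta>" using S by auto
    moreover have "x \<in> Pi\<^sub>E {1..m+1} (restrict S {1..m+1})"
      using x S unfolding mahavier_def by (auto simp: PiE_def)
    ultimately show "x \<in> \<Union>?V" by blast
  qed
qed

lemma mahavier_optimal_cover:
  assumes "\<beta> \<subseteq> \<alpha>" "finite \<beta>" "\<beta> \<noteq> {}" "X \<subseteq> \<Union>\<beta>"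
  obtains V where "V \<subseteq> cover_power \<alpha> (m + 1)" "V \<noteq> {}" "finite V" "mahavier X G m \<subseteq> \<Union>V"
    "card V = cover_number (mahavier X G m) (cover_power \<alpha> (m + 1))"
proof -
  obtain V where "V \<subseteq> cover_power \<alpha> (m + 1)" "V \<noteq> {}" "finite V" "mahavier X G m \<subseteq> \<Union>V"
    by (rule cover_power_finite_subcover[OF assms])
  from cover_number_attained[OF this] show ?thesis using that by blast
qed

text \<open>
  An orbit of \<open>m + n\<close> steps is cut at coordinate \<open>m + 1\<close>, which belongs to both pieces.
  Joining a box for the first piece with a box for the second gives a box for the whole orbit;
  at the shared coordinate only the constraint from the first box is kept, since the
  intersection of the two constraints need not belong to \<open>\<alpha>\<close>.  The finite subcover
  \<open>\<beta>\<close> guarantees that the cover numbers are attained.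
\<close>

lemma cover_number_mahavier_add:
  fixes X :: "'a set" and G :: "('a \<times> 'a) set"
  assumes fin: "\<beta> \<subseteq> \<alpha>" "finite \<beta>" "\<beta> \<noteq> {}" "X \<subseteq> \<Union>\<beta>"
  defines "N \<equiv> \<lambda>m. cover_number (mahavier X G m) (cover_power \<alpha> (m + 1))"
  shows "N (m + n) \<le> N m * N n"
proof -
  obtain V where V: "V \<subseteq> cover_power \<alpha> (m + 1)" "V \<noteq> {}" "finite V"
      "mahavier X G m \<subseteq> \<Union>V" "card V = N m"
    unfolding N_def by (rule mahavier_optimal_cover[OF fin])
  obtain W where W: "W \<subseteq> cover_power \<alpha> (n + 1)" "W \<noteq> {}" "finite W"
      "mahavier X G n \<subseteq> \<Union>W" "card W = N n"
    unfolding N_def by (rule mahavier_optimal_cover[OF fin])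
  have "\<forall>P\<in>V. \<exists>S. P = Pi\<^sub>E {1..m+1} S \<and> (\<forall>i\<in>{1..m+1}. S i \<in> \<alpha>)"
    using V(1) unfolding cover_power_def by blast
  then obtain f where
    f: "\<And>P. P \<in> V \<Longrightarrow> Pi\<^sub>E {1..m+1} (f P) = P"
      "\<And>P i. P \<in> V \<Longrightarrow> i \<in> {1..m+1} \<Longrightarrow> f P i \<in> \<alpha>" by metis
  have "\<forall>Q\<in>W. \<exists>S. Q = Pi\<^sub>E {1..n+1} S \<and> (\<forall>i\<in>{1..n+1}. S i \<in> \<alpha>)"
    using W(1) unfolding cover_power_def by blast
  then obtain g where
    g: "\<And>Q. Q \<in> W \<Longrightarrow> Pi\<^sub>E {1..n+1} (g Q) = Q"
      "\<And>Q i. Q \<in> W \<Longrightarrow> i \<in> {1..n+1} \<Longrightarrow> g Q i \<in> \<alpha>" by metis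
  define box where "box = (\<lambda>(P, Q). Pi\<^sub>E {1..m+n+1} (join m n (f P) (g Q)))"
  have "box ` (V \<times> W) \<subseteq> cover_power \<alpha> (m + n + 1)"
  proof clarify
    fix P Q assume "P \<in> V" "Q \<in> W"
    have "join m n (f P) (g Q) i \<in> \<alpha>" if i: "i \<in> {1..m+n+1}" for i
    proof (cases "i \<le> m + 1")
      case True
      then show ?thesis using f(2)[OF \<open>P \<in> V\<close>] i by (simp add: join_def)
    next
      case False
      then have "i - m \<in> {1..n+1}" using i by auto
      then show ?thesis using g(2)[OF \<open>Q \<in> W\<close>] False i by (simp add: join_def)
    qed
    then show "box (P, Q) \<in> cover_power \<alpha> (m + n + 1)"
      unfolding box_def cover_power_def mem_Collect_eq prod.case
      by (intro exI[of _ "join m n (f P) (g Q)"] conjI refl ballI)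
  qed
  moreover have "mahavier X G (m + n) \<subseteq> \<Union>(box ` (V \<times> W))"
  proof
    fix x assume x: "x \<in> mahavier X G (m + n)"
    obtain P where P: "P \<in> V" "(\<lambda>i\<in>{1..m+1}. x (i + 0)) \<in> P"
      using mahavier_segment[OF x, of 0 m] V(4) by auto
    obtain Q where Q: "Q \<in> W" "(\<lambda>i\<in>{1..n+1}. x (i + m)) \<in> Q"
      using mahavier_segment[OF x, of m n] W(4) by auto
    have left: "x i \<in> f P i" if "i \<in> {1..m+1}" for i
    proof -
      have "(\<lambda>i\<in>{1..m+1}. x (i + 0)) \<in> Pi\<^sub>E {1..m+1} (f P)" using f(1)[OF P(1)] P(2) by simp
      from PiE_mem[OF this that] that show ?thesis by simp
    qed
    have right: "x (i + m) \<in> g Q i" if "i \<in> {1..n+1}" for i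
    proof -
      have "(\<lambda>i\<in>{1..n+1}. x (i + m)) \<in> Pi\<^sub>E {1..n+1} (g Q)" using g(1)[OF Q(1)] Q(2) by simp
      from PiE_mem[OF this that] that show ?thesis by simp
    qed
    have "x i \<in> join m n (f P) (g Q) i" if i: "i \<in> {1..m+n+1}" for i
    proof (cases "i \<le> m + 1")
      case True
      then show ?thesis using left i by (simp add: join_def)
    next
      case False
      then have "i - m \<in> {1..n+1}" using i by auto
      from right[OF this] show ?thesis using False i by (simp add: join_def)
    qed
    moreover have "x \<in> extensional {1..m+n+1}"
      using x by (auto simp: mahavier_def PiE_def)
    ultimately have "x \<in> box (P, Q)"
      unfolding box_def prod.case by (intro PiE_I) (auto simp: extensional_def)
    then show "x \<in> \<Union>(box ` (V \<times> W))" using P(1) Q(1) by blast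
  qed
  ultimately have "N (m + n) \<le> card (box ` (V \<times> W))"
    unfolding N_def using V W by (intro cover_number_le) auto
  also have "\<dots> \<le> card (V \<times> W)" using V W by (intro card_image_le) auto
  finally show ?thesis using V W by (simp add: card_cartesian_product)
qed

lemma convergent_ent_cover:
  fixes X :: "'a set" and G :: "('a \<times> 'a) set"
  assumes "\<beta> \<subseteq> \<alpha>" "finite \<beta>" "\<beta> \<noteq> {}" "X \<subseteq> \<Union>\<beta>"
  shows "convergent
    (\<lambda>m. ln (real (cover_number (mahavier X G m) (cover_power \<alpha> (m + 1)))) / real m)"
proof -
  define N where "N = (\<lambda>m. cover_number (mahavier X G m) (cover_power \<alpha> (m + 1)))"
  have pos: "1 \<le> N m" for m
  proof -
    obtain V where "V \<subseteq> cover_power \<alpha> (m + 1)" "V \<noteq> {}" "finite V"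
        "mahavier X G m \<subseteq> \<Union>V" "card V = N m"
      unfolding N_def by (rule mahavier_optimal_cover[OF assms])
    then show ?thesis by (metis One_nat_def Suc_leI card_gt_0_iff)
  qed
  have "convergent (\<lambda>m. ln (real (N m)) / real m)"
  proof (rule fekete_convergent)
    fix m n
    have "ln (real (N (m + n))) \<le> ln (real (N m * N n))"
    proof (rule ln_mono)
      show "real (N (m + n)) \<le> real (N m * N n)"
        using cover_number_mahavier_add[OF assms, of G m n] unfolding N_def
        by (rule of_nat_mono)
      show "0 < real (N (m + n))" using pos[of "m + n"] by simp
    qed
    also have "\<dots> = ln (real (N m)) + ln (real (N n))"
      using pos[of m] pos[of n] by (simp add: ln_mult)
    finally show "ln (real (N (m + n))) \<le> ln (real (N m)) + ln (real (N n))" .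
  next
    fix n show "0 \<le> ln (real (N n))" using pos[of n] by simp
  qed
  then show ?thesis unfolding N_def .
qed

section \<open>Separated orbits from returns\<close>

text \<open>The returning orbits are described by their number of steps \<open>p = j - 1\<close>.\<close>

lemma has_returnE:
  assumes "has_return X G k \<epsilon> A" "a \<in> A"
  obtains p t x y where "1 \<le> p" "p \<le> k - 1" "1 \<le> t" "t \<le> p + 1"
    "x \<in> mahavier X G p" "y \<in> mahavier X G p" "x 1 = a" "y 1 = a"
    "x (p + 1) \<in> A" "y (p + 1) \<in> A" "dist (x t) (y t) > \<epsilon>"
proof -
  obtain j j' x y where *: "1 < j'" "j' \<le> j" "j \<le> k"
    "x \<in> mahavier X G (j - 1)" "y \<in> mahavier X G (j - 1)"
    "a = x 1" "a = y 1" "{x j, y j} \<subseteq> A" "dist (x j') (y j') > \<epsilon>"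
    using assms unfolding has_return_def by blast
  show ?thesis
    by (rule that[of "j - 1" j' x y]) (use * in auto)
qed

text \<open>Returning to \<open>A\<close> again and again gives orbits of every length.\<close>

lemma has_return_orbit:
  assumes ret: "has_return X G k \<epsilon> A"
  shows "a \<in> A \<Longrightarrow> \<exists>x\<in>mahavier X G m. x 1 = a"
proof (induction m arbitrary: a rule: less_induct)
  case (less m)
  obtain p x where p: "1 \<le> p" "x \<in> mahavier X G p" "x 1 = a" "x (p + 1) \<in> A"
    using has_returnE[OF ret less.prems] by metis
  show ?case
  proof (cases "m \<le> p")
    case True
    then have "(\<lambda>i\<in>{1..m+1}. x (i + 0)) \<in> mahavier X G m"
      by (intro mahavier_segment[OF p(2)]) simp
    then show ?thesis using p(3) by (intro bexI) auto
  next
    case False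
    then obtain z where z: "z \<in> mahavier X G (m - p)" "z 1 = x (p + 1)"
      using less.IH[of "m - p" "x (p + 1)"] p by auto
    have "join p (m - p) x z \<in> mahavier X G m"
      using join_mahavier[OF p(2) z(1)] z(2) False by simp
    moreover have "join p (m - p) x z 1 = a" using p(3) by (simp add: join_left)
    ultimately show ?thesis by blast
  qed
qed

definition orbits_separated :: "nat \<Rightarrow> real \<Rightarrow> (nat \<Rightarrow> 'a::metric_space) set \<Rightarrow> bool" where
  "orbits_separated m \<epsilon> E \<longleftrightarrow>
     (\<forall>u\<in>E. \<forall>v\<in>E. u \<noteq> v \<longrightarrow> (\<exists>i\<in>{1..m+1}. dist (u i) (v i) > \<epsilon>))"

text \<open>
  In the step, a family from the end of each of the two returning orbits is put behind that orbit.
  Two orbits of the result that use the same return are separated by the induction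
  hypothesis, two that use different returns are separated by the return property.  Since the
  number of steps \<open>p\<close> of a return depends on the point of \<open>A\<close>, the length \<open>m\<close> is
  an arbitrary number above the bound, which leaves the hypothesis applicable to \<open>m - p\<close>.
\<close>

lemma has_return_separated:
  fixes X :: "'a::metric_space set"
  assumes ret: "has_return X G k \<epsilon> A" and eps: "\<epsilon> > 0"
  shows "a \<in> A \<Longrightarrow> n * (k - 1) \<le> m \<Longrightarrow>
    \<exists>E\<subseteq>mahavier X G m. finite E \<and> card E = 2 ^ n \<and> (\<forall>u\<in>E. u 1 = a) \<and> orbits_separated m \<epsilon> E"
proof (induction n arbitrary: a m)
  case 0
  obtain x where "x \<in> mahavier X G m" "x 1 = a" using has_return_orbit[OF ret 0(1)] by blast
  then show ?case by (intro exI[of _ "{x}"]) (auto simp: orbits_separated_def)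
next
  case (Suc n)
  obtain p t x y where p: "1 \<le> p" "p \<le> k - 1" and t: "1 \<le> t" "t \<le> p + 1"
    and x: "x \<in> mahavier X G p" and y: "y \<in> mahavier X G p" and start: "x 1 = a" "y 1 = a"
    and home: "x (p + 1) \<in> A" "y (p + 1) \<in> A" and apart: "dist (x t) (y t) > \<epsilon>"
    using has_returnE[OF ret Suc.prems(1)] by metis
  define l where "l = m - p"
  have l: "m = p + l" "n * (k - 1) \<le> l" using Suc.prems(2) p by (auto simp: l_def)
  have extend: "\<exists>F\<subseteq>mahavier X G m. finite F \<and> card F = 2 ^ n \<and>
      (\<forall>u\<in>F. \<forall>i\<in>{1..p+1}. u i = w i) \<and> orbits_separated m \<epsilon> F"
    if w: "w \<in> mahavier X G p" "w (p + 1) \<in> A" for w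
  proof -
    obtain E where E: "E \<subseteq> mahavier X G l" "finite E" "card E = 2 ^ n"
      "\<And>u. u \<in> E \<Longrightarrow> u 1 = w (p + 1)" "orbits_separated l \<epsilon> E"
      using Suc.IH[OF w(2) l(2)] by auto
    have sep: "\<exists>i\<in>{1..m+1}. dist (join p l w u i) (join p l w v i) > \<epsilon>"
      if uv: "u \<in> E" "v \<in> E" "u \<noteq> v" for u v
    proof -
      obtain i where i: "i \<in> {1..l+1}" "dist (u i) (v i) > \<epsilon>"
        using E(5) uv unfolding orbits_separated_def by blast
      have "join p l w z (p + i) = z i" if "z \<in> E" for z
        using join_right[of w p z i l] E(4)[OF that] i(1) by simp
      then show ?thesis
        using uv i l(1) by (intro bexI[of _ "p + i"]) auto
    qed
    have inj: "inj_on (join p l w) E"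
    proof (rule inj_onI, rule ccontr)
      fix u v assume uv: "u \<in> E" "v \<in> E" "join p l w u = join p l w v" "u \<noteq> v"
      show False using sep[OF uv(1,2,4)] uv(3) eps by simp
    qed
    have "join p l w ` E \<subseteq> mahavier X G m"
      using E(1,4) w(1) unfolding l(1) by (auto intro!: join_mahavier)
    moreover have "orbits_separated m \<epsilon> (join p l w ` E)"
      using sep unfolding orbits_separated_def by blast
    ultimately show ?thesis
      using E(2,3) inj
      by (intro exI[of _ "join p l w ` E"]) (auto simp: card_image join_left)
  qed
  obtain F1 where F1: "F1 \<subseteq> mahavier X G m" "finite F1" "card F1 = 2 ^ n"
    "\<And>u i. u \<in> F1 \<Longrightarrow> i \<in> {1..p+1} \<Longrightarrow> u i = x i" "orbits_separated m \<epsilon> F1"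
    using extend[OF x home(1)] by metis
  obtain F2 where F2: "F2 \<subseteq> mahavier X G m" "finite F2" "card F2 = 2 ^ n"
    "\<And>u i. u \<in> F2 \<Longrightarrow> i \<in> {1..p+1} \<Longrightarrow> u i = y i" "orbits_separated m \<epsilon> F2"
    using extend[OF y home(2)] by metis
  have cross: "dist (u t) (v t) > \<epsilon>" "dist (v t) (u t) > \<epsilon>" if "u \<in> F1" "v \<in> F2" for u v
    using F1(4)[OF that(1), of t] F2(4)[OF that(2), of t] apart t by (auto simp: dist_commute)
  have t': "t \<in> {1..m+1}" using t l(1) by simp
  have "F1 \<inter> F2 = {}" using cross eps by fastforce
  then have "card (F1 \<union> F2) = 2 ^ Suc n" using F1 F2 by (simp add: card_Un_disjoint)
  moreover have "orbits_separated m \<epsilon> (F1 \<union> F2)"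
    using F1(5) F2(5) cross t' unfolding orbits_separated_def by blast
  moreover have "\<forall>u\<in>F1 \<union> F2. u 1 = a" using F1(4) F2(4) start by auto
  ultimately show ?case using F1(1,2) F2(1,2) by (intro exI[of _ "F1 \<union> F2"]) auto
qed

text \<open>Two points of a ball of radius \<open>\<epsilon>/2\<close> are at distance less than \<open>\<epsilon>\<close>.\<close>

lemma orbits_separated_box:
  assumes sep: "orbits_separated m \<epsilon> E" and "u \<in> E" "v \<in> E"
    and balls: "\<And>B. B \<in> \<alpha> \<Longrightarrow> \<exists>c. B \<subseteq> ball c (\<epsilon> / 2)"
    and S: "S \<in> cover_power \<alpha> (m + 1)" "u \<in> S" "v \<in> S"
  shows "u = v"
proof (rule ccontr)
  assume "u \<noteq> v"
  then obtain i where i: "i \<in> {1..m+1}" "dist (u i) (v i) > \<epsilon>"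
    using assms(1-3) unfolding orbits_separated_def by blast
  obtain B where B: "B \<in> \<alpha>" "u i \<in> B" "v i \<in> B"
    using S i(1) unfolding cover_power_def by blast
  obtain c where "B \<subseteq> ball c (\<epsilon> / 2)" using balls[OF B(1)] by blast
  then have "dist c (u i) < \<epsilon> / 2" "dist c (v i) < \<epsilon> / 2" using B by auto
  then show False using i(2) dist_triangle3[of "u i" "v i" c] by linarith
qed

section \<open>The entropy bound\<close>

theorem theorem4p13:
  fixes X A :: "'a::metric_space set" and G :: "('a \<times> 'a) set" and k :: nat and \<epsilon> :: real
  assumes "compact X"
    and "A \<subseteq> X"
    and "closed_relation_on X G"
    and "k \<ge> 2"
    and "\<epsilon> > 0"
    and "has_return X G k \<epsilon> A"
  shows "ent X G \<ge> ereal (ln 2 / real k)"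
proof -
  obtain a where a: "a \<in> A" using assms(6) unfolding has_return_def by blast
  define \<alpha> where "\<alpha> = (\<lambda>c. X \<inter> ball c (\<epsilon> / 2)) ` X"
  have cov: "open_cover X \<alpha>"
    using a assms(2,5) by (auto simp: open_cover_def \<alpha>_def openin_open_Int)
  have balls: "\<exists>c. B \<subseteq> ball c (\<epsilon> / 2)" if "B \<in> \<alpha>" for B
    using that unfolding \<alpha>_def by blast
  obtain C where C: "C \<subseteq> X" "finite C" "X \<subseteq> (\<Union>c\<in>C. ball c (\<epsilon> / 2))"
    using compactE_image[OF assms(1), of X "\<lambda>c. ball c (\<epsilon> / 2)"] assms(5) by force
  define \<beta> where "\<beta> = (\<lambda>c. X \<inter> ball c (\<epsilon> / 2)) ` C"
  have \<beta>: "\<beta> \<subseteq> \<alpha>" "finite \<beta>" "\<beta> \<noteq> {}" "X \<subseteq> \<Union>\<beta>"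
    using C a assms(2) unfolding \<alpha>_def \<beta>_def by auto
  define N where "N = (\<lambda>m. cover_number (mahavier X G m) (cover_power \<alpha> (m + 1)))"
  have many: "2 ^ n \<le> N (n * (k - 1))" for n
  proof -
    define m where "m = n * (k - 1)"
    obtain E where E: "E \<subseteq> mahavier X G m" "card E = 2 ^ n" "orbits_separated m \<epsilon> E"
      using has_return_separated[OF assms(6,5) a, of n m] unfolding m_def by auto
    obtain V where V: "V \<subseteq> cover_power \<alpha> (m + 1)" "V \<noteq> {}" "finite V"
        "mahavier X G m \<subseteq> \<Union>V"
      by (rule cover_power_finite_subcover[OF \<beta>])
    have "card E \<le> N m"
      unfolding N_def
      by (rule card_le_cover_number[OF V E(1)])
        (rule orbits_separated_box[OF E(3) _ _ balls])
    then show ?thesis using E(2) m_def by simp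
  qed
  have lim: "(\<lambda>m. ln (real (N m)) / real m) \<longlonglongrightarrow> ent_cover X G \<alpha>"
    using convergent_ent_cover[OF \<beta>, of G] unfolding ent_cover_def N_def
    by (simp only: convergent_LIMSEQ_iff)
  have "strict_mono (\<lambda>n. n * (k - 1))" using assms(4) by (auto simp: strict_mono_def)
  from LIMSEQ_subseq_LIMSEQ[OF lim this]
  have "(\<lambda>n. ln (real (N (n * (k - 1)))) / real (n * (k - 1))) \<longlonglongrightarrow> ent_cover X G \<alpha>"
    by (simp add: o_def)
  moreover have "ln 2 / real (k - 1) \<le> ln (real (N (n * (k - 1)))) / real (n * (k - 1))"
    if "n \<ge> 1" for n
  proof -
    have "real n * ln 2 = ln (2 ^ n)" by (simp add: ln_realpow)
    also have "\<dots> \<le> ln (real (N (n * (k - 1))))"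
    proof (rule ln_mono)
      show "2 ^ n \<le> real (N (n * (k - 1)))" using of_nat_mono[OF many[of n], where 'a = real] by simp
    qed simp
    finally have "real n * ln 2 / real (n * (k - 1)) \<le> ln (real (N (n * (k - 1)))) / real (n * (k - 1))"
      by (rule divide_right_mono) simp
    then show ?thesis using that by simp
  qed
  ultimately have "ln 2 / real (k - 1) \<le> ent_cover X G \<alpha>"
    by (intro LIMSEQ_le_const) auto
  moreover have "ln 2 / real k \<le> ln 2 / real (k - 1)"
    using assms(4) by (intro divide_left_mono) auto
  ultimately have "ereal (ln 2 / real k) \<le> ereal (ent_cover X G \<alpha>)" by simp
  also have "\<dots> \<le> ent X G" unfolding ent_def by (rule SUP_upper) (use cov in simp)
  finally show ?thesis .
qed

end
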